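(* Let $E\subset\mathbb{R}^n$ be open, let $L$ be a continuous vector field on $E$, let $q:E\to\mathbb{R}$ be continuous, and let $\eta\in C^1(E)$ be a solution of $(L+q)\psi=0$ on $E$ with no zeros in $E$. Then the general solution of the equation $(L+q)\psi=0$ is given by $$\psi=\eta\, f(\phi_1,\dots,\phi_{n-1}),$$ where $\phi_i=\phi_i(x_1,\dots,x_n)$ ($i=1,\dots,n-1$) are $n-1$ functionally independent solutions of $L\phi=0$ and $f$ is an arbitrary $C^1$ function in its arguments.
   Context: In a global system of coordinates $(x_1,\dots,x_n)$ on $E$, $L=\sum_{k=1}^n a_k(x_1,\dots,x_n)\,\partial/\partial x_k$ with $a_k\in C^0(E)$. It acts on $C^1(E)$ by $L\psi=\sum_k a_k\,\partial\psi/\partial x_k$, and $(L+q)\psi=L\psi+q\psi$. Solutions are $C^1$ functions. "Functionally independent" has its usual meaning (linearly independent differentials). "General solution" means that the functions of the indicated form, as $f$ varies, are the solutions of the equation.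
   Formalization: That every solution has the form η f(φ) is proved only if L vanishes on no nonempty open subset of E; then locally near each point, and on all of E if the common level sets of the φ_i are connected (n=1: E connected). Independence is at every point; f is C^1 on the image of φ. *)

theory Defs
  imports "HOL-Analysis.Analysis"
begin

definition partial_derivative :: "'n::finite \<Rightarrow> (real^'n \<Rightarrow> real) \<Rightarrow> real^'n \<Rightarrow> real" where
  "partial_derivative k f x = frechet_derivative f (at x) (axis k 1)"

definition gradient :: "(real^'n::finite \<Rightarrow> real) \<Rightarrow> real^'n \<Rightarrow> real^'n" where
  "gradient f x = (\<chi> k. partial_derivative k f x)"

text \<open>Intended for open \<open>S\<close>; it then depends only on the values of \<open>f\<close> on \<open>S\<close>.\<close>

definition C1_on :: "(real^'n::finite) set \<Rightarrow> (real^'n \<Rightarrow> real) \<Rightarrow> bool" where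
  "C1_on S f \<longleftrightarrow> (\<forall>x\<in>S. f differentiable (at x)) \<and>
     (\<forall>k. continuous_on S (partial_derivative k f))"

text \<open>A vector field is given by its components: \<open>a x $ k\<close> is the coefficient of the
  \<open>k\<close>-th partial derivative at \<open>x\<close>.\<close>

definition vf_apply :: "(real^'n::finite \<Rightarrow> real^'n) \<Rightarrow> (real^'n \<Rightarrow> real) \<Rightarrow> real^'n \<Rightarrow> real" where
  "vf_apply a f x = (\<Sum>k\<in>UNIV. a x $ k * partial_derivative k f x)"

definition solutions ::
    "(real^'n::finite \<Rightarrow> real^'n) \<Rightarrow> (real^'n \<Rightarrow> real) \<Rightarrow> (real^'n) set \<Rightarrow> (real^'n \<Rightarrow> real) set" where
  "solutions a q U = {\<psi>. C1_on U \<psi> \<and> (\<forall>x\<in>U. vf_apply a \<psi> x + q x * \<psi> x = 0)}"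

definition functionally_independent_on ::
    "(real^'n::finite) set \<Rightarrow> ('m::finite \<Rightarrow> real^'n \<Rightarrow> real) \<Rightarrow> bool" where
  "functionally_independent_on S \<phi> \<longleftrightarrow>
     (\<forall>x\<in>S. inj (\<lambda>i. gradient (\<phi> i) x) \<and> independent (range (\<lambda>i. gradient (\<phi> i) x)))"

definition tuple :: "('m::finite \<Rightarrow> 'a \<Rightarrow> real) \<Rightarrow> 'a \<Rightarrow> real^'m" where
  "tuple \<phi> x = (\<chi> i. \<phi> i x)"

text \<open>When \<open>U\<close> is open and the \<open>\<phi> i\<close> are $C^1$ and functionally independent on \<open>U\<close>, the image
  \<open>tuple \<phi> ` U\<close> is open, so \<open>C1_on\<close> has its usual meaning below. Functions on \<open>U\<close> are
  represented by total functions whose values outside \<open>U\<close> are irrelevant.\<close>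

definition solution_forms ::
    "(real^'n::finite \<Rightarrow> real) \<Rightarrow> ('m::finite \<Rightarrow> real^'n \<Rightarrow> real) \<Rightarrow> (real^'n) set
      \<Rightarrow> (real^'n \<Rightarrow> real) set" where
  "solution_forms \<eta> \<phi> U =
     {\<psi>. \<exists>f. C1_on (tuple \<phi> ` U) f \<and> (\<forall>x\<in>U. \<psi> x = \<eta> x * f (tuple \<phi> x))}"

text \<open>The same for an empty family \<open>\<phi>\<close> (dimension one), where \<open>f\<close> has no arguments and is a
  constant; index types are nonempty, so this case cannot be an instance of the above.\<close>

definition solution_forms0 ::
    "(real^'n::finite \<Rightarrow> real) \<Rightarrow> (real^'n) set \<Rightarrow> (real^'n \<Rightarrow> real) set" where
  "solution_forms0 \<eta> U = {\<psi>. \<exists>c. \<forall>x\<in>U. \<psi> x = \<eta> x * c}"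

text \<open>Every point of \<open>E\<close> has arbitrarily small open neighbourhoods on which the solutions are
  exactly the functions of the form \<open>F\<close>.\<close>

definition local_general_solution ::
    "(real^'n::finite \<Rightarrow> real^'n) \<Rightarrow> (real^'n \<Rightarrow> real) \<Rightarrow> (real^'n) set
      \<Rightarrow> ((real^'n) set \<Rightarrow> (real^'n \<Rightarrow> real) set) \<Rightarrow> bool" where
  "local_general_solution a q E F \<longleftrightarrow>
     (\<forall>x\<in>E. \<forall>W. open W \<and> x \<in> W \<longrightarrow>
        (\<exists>U. open U \<and> x \<in> U \<and> U \<subseteq> W \<inter> E \<and> solutions a q U = F U))"

end

theory Submission
  imports Defs
begin

text \<open>
  Dividing by the zero-free solution \<open>\<eta>\<close> reduces everything to $q = 0$: a function \<open>\<psi>\<close> solves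
  $(L+q)\psi = 0$ iff $g = \psi/\eta$ solves $Lg = 0$ (\<open>solutions_mult\<close>, \<open>solutions_inverse\<close>).
  By the chain rule every $C^1$ function of first integrals $\phi_1, \dots, \phi_{n-1}$ is again a
  first integral (\<open>compose_solution\<close>).

  Conversely, let $Lg = 0$. At a point where $a \neq 0$ the kernel of $d\phi$ is a line, since the
  $n - 1$ gradients are independent, and it contains $a$; so it is spanned by $a$, and $dg$ vanishes
  on it (\<open>jacobian_kernel_spanned\<close>). As the zeros of $a$ have empty interior, continuity extends
  this to all points. In coordinates in which \<open>\<phi>\<close> is a surjective linear map
  (\<open>submersion_straightening\<close>, from the inverse function theorem), $g$ then has zero derivative
  along the fibres of that map, so it is constant on them over a ball, and it equals $f \circ \phi$
  there with $f$ of class $C^1$ (\<open>local_factorization\<close>). Without the condition on the zeros of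
  $a$ the converse fails: where $a$ vanishes on an open set, every $C^1$ function is a first integral.

  For the factorization on all of $E$ one needs $g$ to be constant on whole fibres of \<open>\<phi>\<close>. It is
  locally constant on them, so connectedness of the fibres suffices
  (\<open>first_integral_global_factorization\<close>). In dimension one there are no $\phi_i$, and the same
  argument gives $dg = 0$ (\<open>first_integral_constant_dim1\<close>).
\<close>

section \<open>Gradients and continuously differentiable functions\<close>

lemma gradient_eqI:
  assumes "(f has_derivative (\<lambda>h. d \<bullet> h)) (at x)"
  shows "gradient f x = d"
  by (simp add: gradient_def partial_derivative_def vec_eq_iff inner_axis
      flip: frechet_derivative_at[OF assms])

lemma has_derivative_gradient:
  assumes "f differentiable (at x)"
  shows "(f has_derivative (\<lambda>h. gradient f x \<bullet> h)) (at x)"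
proof -
  let ?F = "frechet_derivative f (at x)"
  have F: "(f has_derivative ?F) (at x)"
    using assms by (simp add: frechet_derivative_works)
  then have lin: "linear ?F"
    by (rule has_derivative_linear)
  have "?F h = gradient f x \<bullet> h" for h
  proof -
    have "?F h = ?F (\<Sum>k\<in>UNIV. h $ k *\<^sub>R axis k 1)"
      by (simp add: basis_expansion flip: scalar_mult_eq_scaleR)
    also have "\<dots> = (\<Sum>k\<in>UNIV. h $ k * ?F (axis k 1))"
      by (simp add: linear_sum[OF lin] linear_cmul[OF lin])
    finally show ?thesis
      by (simp add: gradient_def partial_derivative_def inner_vec_def mult.commute)
  qed
  then have "?F = (\<lambda>h. gradient f x \<bullet> h)" by (rule ext)
  with F show ?thesis by simp
qed

lemma C1_on_has_derivative:
  assumes "C1_on S f" "x \<in> S"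
  shows "(f has_derivative (\<lambda>h. gradient f x \<bullet> h)) (at x)"
  using assms by (auto simp: C1_on_def intro: has_derivative_gradient)

lemma C1_on_continuous_gradient: "C1_on S f \<Longrightarrow> continuous_on S (gradient f)"
  unfolding C1_on_def gradient_def by (intro continuous_intros) auto

lemma C1_onI:
  assumes "\<And>x. x \<in> S \<Longrightarrow> (f has_derivative (\<lambda>h. d x \<bullet> h)) (at x)" "continuous_on S d"
  shows "C1_on S f"
proof -
  have "partial_derivative k f x = d x $ k" if "x \<in> S" for x k
    using arg_cong[OF gradient_eqI[OF assms(1)[OF that]], of "\<lambda>v. v $ k"] by (simp add: gradient_def)
  then have "continuous_on S (partial_derivative k f) \<longleftrightarrow> continuous_on S (\<lambda>x. d x $ k)" for k
    by (intro continuous_on_cong) auto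
  then have "continuous_on S (partial_derivative k f)" for k
    using continuous_on_component[OF assms(2)] by blast
  with assms(1) show ?thesis
    unfolding C1_on_def differentiable_def by blast
qed

lemma C1_on_subset: "C1_on S f \<Longrightarrow> T \<subseteq> S \<Longrightarrow> C1_on T f"
  unfolding C1_on_def by (blast intro: continuous_on_subset)

lemma C1_on_imp_continuous_on: "C1_on S f \<Longrightarrow> continuous_on S f"
  using C1_on_has_derivative
  by (blast intro: continuous_at_imp_continuous_on has_derivative_continuous)

lemma gradient_cong:
  assumes "open S" "x \<in> S" "\<And>x. x \<in> S \<Longrightarrow> f x = g x" "f differentiable (at x)"
  shows "gradient g x = gradient f x"
  by (rule gradient_eqI)
     (rule has_derivative_transform_within_open[OF has_derivative_gradient[OF assms(4)] assms(1,2,3)])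

lemma C1_on_cong:
  assumes "open S" "\<And>x. x \<in> S \<Longrightarrow> f x = g x" "C1_on S f"
  shows "C1_on S g"
proof (rule C1_onI)
  show "continuous_on S (gradient f)"
    using assms(3) by (rule C1_on_continuous_gradient)
  show "(g has_derivative (\<lambda>h. gradient f x \<bullet> h)) (at x)" if "x \<in> S" for x
    using has_derivative_transform_within_open[OF C1_on_has_derivative[OF assms(3) that] assms(1) that]
      assms(2) by auto
qed

lemma C1_on_local:
  assumes "\<And>x. x \<in> S \<Longrightarrow> \<exists>T. open T \<and> x \<in> T \<and> C1_on T f"
  shows "C1_on S f"
proof (rule C1_onI)
  show "(f has_derivative (\<lambda>h. gradient f x \<bullet> h)) (at x)" if "x \<in> S" for x
    using assms[OF that] C1_on_has_derivative by blast
  have "continuous (at x) (gradient f)" if "x \<in> S" for x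
    using assms[OF that] C1_on_continuous_gradient continuous_on_eq_continuous_at by blast
  then show "continuous_on S (gradient f)"
    by (simp add: continuous_at_imp_continuous_on)
qed

lemma C1_on_mult:
  assumes "C1_on S f" "C1_on S g"
  shows "C1_on S (\<lambda>x. f x * g x)"
    and gradient_mult: "x \<in> S \<Longrightarrow> gradient (\<lambda>x. f x * g x) x = f x *\<^sub>R gradient g x + g x *\<^sub>R gradient f x"
proof -
  have D: "((\<lambda>x. f x * g x) has_derivative (\<lambda>h. (f x *\<^sub>R gradient g x + g x *\<^sub>R gradient f x) \<bullet> h)) (at x)"
    if "x \<in> S" for x
    by (rule has_derivative_eq_rhs[OF has_derivative_mult[OF assms[THEN C1_on_has_derivative[OF _ that]]]])
       (simp add: fun_eq_iff algebra_simps inner_add_left)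
  show "C1_on S (\<lambda>x. f x * g x)"
    by (rule C1_onI[OF D], assumption)
       (intro continuous_intros C1_on_continuous_gradient C1_on_imp_continuous_on assms)
  show "x \<in> S \<Longrightarrow> gradient (\<lambda>x. f x * g x) x = f x *\<^sub>R gradient g x + g x *\<^sub>R gradient f x"
    by (rule gradient_eqI[OF D])
qed

lemma C1_on_inverse:
  assumes "C1_on S f" "\<And>x. x \<in> S \<Longrightarrow> f x \<noteq> 0"
  shows "C1_on S (\<lambda>x. inverse (f x))"
    and gradient_inverse: "x \<in> S \<Longrightarrow> gradient (\<lambda>x. inverse (f x)) x = - (inverse (f x))\<^sup>2 *\<^sub>R gradient f x"
proof -
  have D: "((\<lambda>x. inverse (f x)) has_derivative (\<lambda>h. (- (inverse (f x))\<^sup>2 *\<^sub>R gradient f x) \<bullet> h)) (at x)"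
    if "x \<in> S" for x
    by (rule has_derivative_eq_rhs[OF Deriv.has_derivative_inverse[OF assms(2)[OF that] C1_on_has_derivative[OF assms(1) that]]])
       (simp add: fun_eq_iff power2_eq_square)
  show "C1_on S (\<lambda>x. inverse (f x))"
    by (rule C1_onI[OF D], assumption)
       (intro continuous_intros C1_on_continuous_gradient C1_on_imp_continuous_on ballI assms)
  show "x \<in> S \<Longrightarrow> gradient (\<lambda>x. inverse (f x)) x = - (inverse (f x))\<^sup>2 *\<^sub>R gradient f x"
    by (rule gradient_eqI[OF D])
qed

definition jacobian :: "('m::finite \<Rightarrow> real^'n::finite \<Rightarrow> real) \<Rightarrow> real^'n \<Rightarrow> real^'n^'m" where
  "jacobian u x = (\<chi> i. gradient (u i) x)"

lemma jacobian_mult_nth: "(jacobian u x *v h) $ i = gradient (u i) x \<bullet> h"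
  by (simp add: jacobian_def matrix_vector_mult_def inner_vec_def)

lemma has_derivative_tuple:
  fixes u :: "'m::finite \<Rightarrow> real^'n::finite \<Rightarrow> real"
  assumes "\<And>i. C1_on S (u i)" "x \<in> S"
  shows "(tuple u has_derivative (\<lambda>h. jacobian u x *v h)) (at x)"
proof (subst has_derivative_componentwise_within, intro ballI)
  fix b :: "real^'m" assume "b \<in> Basis"
  then obtain i where "b = axis i 1" by (auto simp: Basis_vec_def)
  then show "((\<lambda>y. tuple u y \<bullet> b) has_derivative (\<lambda>h. (jacobian u x *v h) \<bullet> b)) (at x)"
    using C1_on_has_derivative[OF assms] by (simp add: inner_axis jacobian_mult_nth tuple_def)
qed

lemma continuous_on_jacobian:
  assumes "\<And>i. C1_on S (u i)"
  shows "continuous_on S (jacobian u)"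
  unfolding jacobian_def by (intro continuous_intros C1_on_continuous_gradient assms)

text \<open>The set \<open>T\<close> is typically the image of \<open>S\<close> under the tuple. Since \<open>C1_on\<close> asks for
  differentiability in the ambient space, the ordinary chain rule applies at each of its points.\<close>
lemma C1_on_compose:
  assumes f: "C1_on T f" and u: "\<And>i. C1_on S (u i)" and "tuple u ` S \<subseteq> T"
  shows "C1_on S (\<lambda>x. f (tuple u x))"
    and gradient_compose:
      "x \<in> S \<Longrightarrow> gradient (\<lambda>x. f (tuple u x)) x \<bullet> h = gradient f (tuple u x) \<bullet> (jacobian u x *v h)"
proof -
  let ?d = "\<lambda>x. gradient f (tuple u x) v* jacobian u x"
  have D: "((\<lambda>x. f (tuple u x)) has_derivative (\<lambda>h. ?d x \<bullet> h)) (at x)" if "x \<in> S" for x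
  proof -
    have "tuple u x \<in> T" using assms(3) that by auto
    from has_derivative_compose[OF has_derivative_tuple[OF u that] C1_on_has_derivative[OF f this]]
    show ?thesis by (simp add: dot_lmul_matrix)
  qed
  have "continuous_on S (tuple u)"
    using has_derivative_tuple[OF u] by (fastforce intro: continuous_at_imp_continuous_on has_derivative_continuous)
  then have "continuous_on S (\<lambda>x. gradient f (tuple u x))"
    using continuous_on_compose2[OF C1_on_continuous_gradient[OF f]] assms(3) by blast
  then have "continuous_on S ?d"
    unfolding vector_matrix_mult_def
    by (intro continuous_intros continuous_on_jacobian u)
  with D show "C1_on S (\<lambda>x. f (tuple u x))" by (rule C1_onI)
  show "x \<in> S \<Longrightarrow> gradient (\<lambda>x. f (tuple u x)) x \<bullet> h = gradient f (tuple u x) \<bullet> (jacobian u x *v h)"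
    using gradient_eqI[OF D] by (simp add: dot_lmul_matrix)
qed

lemma vf_apply_gradient: "vf_apply a f x = a x \<bullet> gradient f x"
  by (simp add: vf_apply_def gradient_def inner_vec_def)

text \<open>By Cramer's rule the solution is a quotient of determinants, hence of polynomials in the
  entries of the matrix. This gives the continuity of the derivative of a local inverse.\<close>
lemma continuous_on_linear_solution:
  fixes A :: "'a::topological_space \<Rightarrow> real^'n::finite^'n"
  assumes "continuous_on S A" "\<And>y. y \<in> S \<Longrightarrow> det (A y) \<noteq> 0" "\<And>y. y \<in> S \<Longrightarrow> A y *v w y = h"
  shows "continuous_on S w"
proof -
  define c where "c = (\<lambda>y. \<chi> k. det (\<chi> i j. if j = k then h $ i else A y $ i $ j) / det (A y))"
  have A: "continuous_on S (\<lambda>y. A y $ i $ j)" for i j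
    by (intro continuous_on_component assms(1))
  have "continuous_on S (\<lambda>y. if j = k then h $ i else A y $ i $ j)" for i j k
    by (cases "j = k") (simp_all add: A)
  then have "continuous_on S (\<lambda>y. det (\<chi> i j. if j = k then h $ i else A y $ i $ j))" for k
    unfolding det_def by (simp add: continuous_on_sum continuous_on_mult continuous_on_prod)
  moreover have "continuous_on S (\<lambda>y. det (A y))"
    unfolding det_def by (intro continuous_intros A)
  ultimately have "continuous_on S c"
    unfolding c_def using assms(2)
    by (intro continuous_on_vec_lambda continuous_on_divide) auto
  moreover have "c y = w y" if "y \<in> S" for y
    using cramer[OF assms(2)[OF that], of "w y" h] assms(3)[OF that] unfolding c_def by simp
  ultimately show ?thesis
    using continuous_on_cong[of S S c w] by simp
qed

section \<open>Functions constant along the fibres of a submersion\<close>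

lemma tuple_components [simp]: "tuple (\<lambda>k x. g x $ k) = g"
  by (simp add: tuple_def fun_eq_iff)

text \<open>Continuity of the derivative is only asked for pointwise on vectors, which in finite dimension
  is the same as continuity in operator norm and is what Cramer's rule provides.\<close>
lemma C1_on_components:
  fixes g :: "real^'n::finite \<Rightarrow> real^'m::finite"
  assumes "\<And>y. y \<in> S \<Longrightarrow> (g has_derivative g' y) (at y)"
    and "\<And>h. continuous_on S (\<lambda>y. g' y h)"
  shows "C1_on S (\<lambda>y. g y $ k)"
proof -
  have D: "((\<lambda>y. g y $ k) has_derivative (\<lambda>h. g' y h $ k)) (at y)" if "y \<in> S" for y
    by (rule bounded_linear.has_derivative[OF bounded_linear_vec_nth assms(1)[OF that]])
  have "partial_derivative j (\<lambda>y. g y $ k) y = g' y (axis j 1) $ k" if "y \<in> S" for j y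
    by (simp add: partial_derivative_def flip: frechet_derivative_at[OF D[OF that]])
  then have "continuous_on S (partial_derivative j (\<lambda>y. g y $ k)) \<longleftrightarrow>
      continuous_on S (\<lambda>y. g' y (axis j 1) $ k)" for j
    by (intro continuous_on_cong) auto
  then have "continuous_on S (partial_derivative j (\<lambda>y. g y $ k))" for j
    using continuous_on_component[OF assms(2)] by blast
  with D show ?thesis
    unfolding C1_on_def differentiable_def by blast
qed

text \<open>Let $D = d\phi(x_0)$ and let $B$ be a right inverse of it. The map
  $\Phi(x) = B\phi(x) + (x - BDx)$ has derivative $BD + (1 - BD) = 1$ at $x_0$, so it is a local
  diffeomorphism there, and $D\Phi(x) = \phi(x) + (Dx - Dx) = \phi(x)$. Its local inverse $\Psi$
  therefore turns \<open>\<phi>\<close> into the linear map $D$. Complementing \<open>\<phi>\<close> inside the source space keeps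
  both sides of the inverse function theorem of the same type, so no splitting of the index type
  is required. The domain of $\Psi$ is a ball so that the fibres of $D$ in it are convex.\<close>
lemma submersion_straightening:
  fixes \<phi> :: "'m::finite \<Rightarrow> real^'n::finite \<Rightarrow> real"
  assumes "open E" "x0 \<in> E" and C1: "\<And>i. C1_on E (\<phi> i)"
    and B: "jacobian \<phi> x0 ** B = mat 1"
  obtains \<Psi> y0 r where
    "r > 0" "x0 \<in> \<Psi> ` ball y0 r" "\<Psi> ` ball y0 r \<subseteq> E"
    "\<And>W. open W \<Longrightarrow> W \<subseteq> ball y0 r \<Longrightarrow> open (\<Psi> ` W)"
    "\<And>k. C1_on (ball y0 r) (\<lambda>y. \<Psi> y $ k)"
    "\<And>y. y \<in> ball y0 r \<Longrightarrow> tuple \<phi> (\<Psi> y) = jacobian \<phi> x0 *v y"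
proof -
  define D where "D = jacobian \<phi> x0"
  have DB: "D *v (B *v z) = z" for z
    using B by (simp add: D_def matrix_vector_mul_assoc)
  define \<Phi> where "\<Phi> x = B *v tuple \<phi> x + (x - B *v (D *v x))" for x
  define M where "M x = B ** jacobian \<phi> x + (mat 1 - B ** D)" for x
  have M: "M x *v h = B *v (jacobian \<phi> x *v h) + (h - B *v (D *v h))" for x h
    by (simp add: M_def matrix_vector_mult_add_rdistrib matrix_vector_mult_diff_rdistrib
        matrix_vector_mul_assoc)
  have D\<Phi>: "D *v \<Phi> x = tuple \<phi> x" for x
    by (simp add: \<Phi>_def matrix_vector_right_distrib matrix_vector_mult_diff_distrib DB)
  let ?M = "\<lambda>x. Blinfun ((*v) (M x))"
  have M_apply: "blinfun_apply (?M x) = (*v) (M x)" for x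
    by (simp add: bounded_linear_Blinfun_apply)
  have "(\<Phi> has_derivative blinfun_apply (?M x)) (at x)" if "x \<in> E" for x
    unfolding M_apply M \<Phi>_def
    by (intro has_derivative_add has_derivative_diff has_derivative_ident
        bounded_linear.has_derivative[OF matrix_vector_mul_bounded_linear]
        has_derivative_tuple[OF C1 that])
  moreover have contM: "continuous_on E M"
    unfolding M_def matrix_matrix_mult_def
    by (intro continuous_intros continuous_on_jacobian C1)
  have "continuous_on E ?M"
  proof (rule continuous_on_blinfun_componentwise)
    show "continuous_on E (\<lambda>x. blinfun_apply (?M x) h)" for h
      unfolding M_apply matrix_vector_mult_def by (intro continuous_intros contM)
  qed
  moreover have "M x0 *v h = h" for h
    by (simp add: M flip: D_def)
  then have "id_blinfun o\<^sub>L ?M x0 = id_blinfun"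
    by (intro blinfun_eqI) (simp add: M_apply)
  ultimately obtain U V \<Psi> \<Psi>' where UV: "open U" "U \<subseteq> E" "x0 \<in> U" "open V" "\<Phi> x0 \<in> V"
    and hom: "homeomorphism U V \<Phi> \<Psi>"
    and D\<Psi>: "\<And>y. y \<in> V \<Longrightarrow> (\<Psi> has_derivative (\<Psi>' y)) (at y)"
    and inv: "\<And>y. y \<in> V \<Longrightarrow> \<Psi>' y = inv (blinfun_apply (?M (\<Psi> y)))"
    and bij: "\<And>y. y \<in> V \<Longrightarrow> bij (blinfun_apply (?M (\<Psi> y)))"
    using inverse_function_theorem[OF \<open>open E\<close> _ _ \<open>x0 \<in> E\<close>, of \<Phi> ?M id_blinfun] by metis
  have \<Psi>V: "\<Psi> ` V = U" "\<And>y. y \<in> V \<Longrightarrow> \<Phi> (\<Psi> y) = y" "\<And>x. x \<in> U \<Longrightarrow> \<Psi> (\<Phi> x) = x"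
    using hom by (auto simp: homeomorphism_def)
  have cont\<Psi>: "continuous_on V \<Psi>"
    using hom by (simp add: homeomorphism_def)
  have MV: "continuous_on V (\<lambda>y. M (\<Psi> y))"
    by (rule continuous_on_compose2[OF contM cont\<Psi>]) (use \<Psi>V UV in auto)
  have detM: "det (M (\<Psi> y)) \<noteq> 0" if "y \<in> V" for y
    using bij[OF that] det_nz_iff_inj[of "(*v) (M (\<Psi> y))"] unfolding M_apply
    by (simp add: bij_is_inj)
  have M\<Psi>': "M (\<Psi> y) *v \<Psi>' y h = h" if "y \<in> V" for y h
    using bij[OF that] unfolding inv[OF that] M_apply by (simp add: bij_is_surj surj_f_inv_f)
  have cont\<Psi>': "continuous_on V (\<lambda>y. \<Psi>' y h)" for h
    by (rule continuous_on_linear_solution[OF MV detM M\<Psi>'])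
  have C1\<Psi>: "C1_on V (\<lambda>y. \<Psi> y $ k)" for k
    by (rule C1_on_components[OF D\<Psi> cont\<Psi>'])
  obtain r where r: "r > 0" "ball (\<Phi> x0) r \<subseteq> V"
    using UV openE by blast
  show thesis
  proof (rule that[of r \<Psi> "\<Phi> x0"])
    show "r > 0" by fact
    show "x0 \<in> \<Psi> ` ball (\<Phi> x0) r"
      using r \<Psi>V(3)[OF UV(3)] by (metis centre_in_ball image_eqI)
    show "\<Psi> ` ball (\<Phi> x0) r \<subseteq> E"
      using r \<Psi>V UV by blast
    show "open (\<Psi> ` W)" if "open W" "W \<subseteq> ball (\<Phi> x0) r" for W
    proof -
      have "W \<subseteq> V" using that r by blast
      then have "openin (top_of_set V) W" using that(1) by (simp add: open_subset)
      then have "openin (top_of_set U) (\<Psi> ` W)"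
        using homeomorphism_imp_open_map hom homeomorphism_sym by blast
      then show ?thesis using UV(1) openin_open_trans by blast
    qed
    show "C1_on (ball (\<Phi> x0) r) (\<lambda>y. \<Psi> y $ k)" for k
      using C1\<Psi> r(2) by (rule C1_on_subset)
    show "tuple \<phi> (\<Psi> y) = jacobian \<phi> x0 *v y" if "y \<in> ball (\<Phi> x0) r" for y
      using D\<Phi>[of "\<Psi> y"] \<Psi>V(2) r(2) that by (auto simp: D_def)
  qed
qed

text \<open>In the straightened coordinates the differential of $G = g \circ \Psi$ vanishes on the kernel of
  $D$, at first off the exceptional set \<open>Z\<close> and then everywhere, because the points where it does
  not vanish form an open set that $\Psi$ maps to an open subset of \<open>Z\<close>. So $G$ is constant on the
  convex fibres of $D$ and descends to a function $f$ on the image. Near $Dy$ one has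
  $f(z) = G(y + B(z - Dy))$, a composition of $C^1$ maps.

  The neighbourhood does not depend on $g$: a local general solution needs one neighbourhood
  that serves all solutions.\<close>
lemma local_factorization:
  fixes \<phi> :: "'m::finite \<Rightarrow> real^'n::finite \<Rightarrow> real"
  assumes "open E" "x0 \<in> E" and C1: "\<And>i. C1_on E (\<phi> i)"
    and B: "jacobian \<phi> x0 ** B = mat 1"
  obtains U where "open U" "x0 \<in> U" "U \<subseteq> E" "open (tuple \<phi> ` U)"
    "\<And>g Z. C1_on U g \<Longrightarrow> interior Z = {} \<Longrightarrow>
       (\<And>x v. x \<in> U - Z \<Longrightarrow> jacobian \<phi> x *v v = 0 \<Longrightarrow> gradient g x \<bullet> v = 0) \<Longrightarrow>
       \<exists>f. C1_on (tuple \<phi> ` U) f \<and> (\<forall>x\<in>U. g x = f (tuple \<phi> x))"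
proof -
  define D where "D = jacobian \<phi> x0"
  have DB: "D *v (B *v z) = z" for z
    using B by (simp add: D_def matrix_vector_mul_assoc)
  obtain \<Psi> y0 r where r: "r > 0" "x0 \<in> \<Psi> ` ball y0 r" "\<Psi> ` ball y0 r \<subseteq> E"
    and open\<Psi>: "\<And>W. open W \<Longrightarrow> W \<subseteq> ball y0 r \<Longrightarrow> open (\<Psi> ` W)"
    and C1\<Psi>: "\<And>k. C1_on (ball y0 r) (\<lambda>y. \<Psi> y $ k)"
    and \<phi>\<Psi>: "\<And>y. y \<in> ball y0 r \<Longrightarrow> tuple \<phi> (\<Psi> y) = D *v y"
    by (rule submersion_straightening[OF assms, folded D_def]) (rule that)
  define V where "V = ball y0 r"
  define U where "U = \<Psi> ` V"
  note defs = r[folded V_def, folded U_def] open\<Psi>[folded V_def] C1\<Psi>[folded V_def] \<phi>\<Psi>[folded V_def]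
  have \<phi>U: "tuple \<phi> ` U = (*v) D ` V"
    unfolding U_def using defs(6) by (auto simp: image_iff)
  have "open ((*v) D ` V)"
    using surjI[of "(*v) D" "(*v) B", OF DB]
    by (intro open_surjective_linear_image) (auto simp: V_def)
  show thesis
  proof (rule that[of U])
    show "open U" unfolding U_def using defs(4)[of V] by (simp add: V_def)
    show "x0 \<in> U" "U \<subseteq> E" using defs by auto
    show "open (tuple \<phi> ` U)" unfolding \<phi>U by fact
  next
    fix g Z
    assume g: "C1_on U g" and Z: "interior Z = {}"
      and ker: "\<And>x v. x \<in> U - Z \<Longrightarrow> jacobian \<phi> x *v v = 0 \<Longrightarrow> gradient g x \<bullet> v = 0"
    let ?J = "jacobian (\<lambda>k y. \<Psi> y $ k)"
    define G where "G y = g (\<Psi> y)" for y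
    have G: "C1_on V G" and
      dG: "\<And>y h. y \<in> V \<Longrightarrow> gradient G y \<bullet> h = gradient g (\<Psi> y) \<bullet> (?J y *v h)"
      using C1_on_compose[where u = "\<lambda>k y. \<Psi> y $ k", OF g defs(5)] gradient_compose[where u = "\<lambda>k y. \<Psi> y $ k", OF g defs(5)]
      unfolding G_def by (auto simp: U_def)
    \<comment> \<open>The differentiated form of \<open>\<phi> \<circ> \<Psi> = D\<close>.\<close>
    have J: "jacobian \<phi> (\<Psi> y) *v (?J y *v h) = D *v h" if "y \<in> V" for y h
    proof -
      have "(jacobian \<phi> (\<Psi> y) *v (?J y *v h)) $ i = (D *v h) $ i" for i
      proof -
        have "gradient (\<lambda>y. \<phi> i (\<Psi> y)) y = gradient (\<phi> i) x0"
        proof (rule gradient_eqI, rule has_derivative_transform_within_open)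
          show "((\<lambda>y. gradient (\<phi> i) x0 \<bullet> y) has_derivative (\<lambda>h. gradient (\<phi> i) x0 \<bullet> h)) (at y)"
            by (intro derivative_eq_intros) auto
          show "open V" by (simp add: V_def)
          show "y \<in> V" by fact
          show "gradient (\<phi> i) x0 \<bullet> z = \<phi> i (\<Psi> z)" if "z \<in> V" for z
            using arg_cong[OF defs(6)[OF that], of "\<lambda>v. v $ i"]
            by (simp add: D_def jacobian_mult_nth tuple_def)
        qed
        then show ?thesis
          using gradient_compose[where u = "\<lambda>k y. \<Psi> y $ k" and h = h, OF C1[of i] defs(5) _ that] defs(3)
          by (simp add: D_def jacobian_mult_nth U_def)
      qed
      then show ?thesis by (simp add: vec_eq_iff)
    qed
    have G0: "gradient G y \<bullet> h = 0" if "y \<in> V" and h: "D *v h = 0" for y h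
    proof -
      define W where "W = V \<inter> (\<lambda>y. gradient G y \<bullet> h) -` (- {0})"
      have "open W"
        unfolding W_def
        by (intro continuous_open_preimage continuous_intros C1_on_continuous_gradient[OF G])
           (auto simp: V_def)
      moreover have "\<Psi> ` W \<subseteq> Z"
        using dG J ker h by (fastforce simp: W_def U_def)
      ultimately have "\<Psi> ` W \<subseteq> interior Z"
        using defs(4) by (intro interior_maximal) (auto simp: W_def)
      with Z that show ?thesis by (auto simp: W_def)
    qed
    have Geq: "G y = G y'" if "y \<in> V" "y' \<in> V" "D *v y = D *v y'" for y y'
    proof -
      let ?p = "\<lambda>t. y + t *\<^sub>R (y' - y)"
      have p: "?p t \<in> V" if "t \<in> {0..1}" for t
        using convexD_alt[of V y y' t] \<open>y \<in> V\<close> \<open>y' \<in> V\<close> that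
        by (simp add: V_def algebra_simps)
      have "((\<lambda>t. G (?p t)) has_derivative (\<lambda>h. 0)) (at t within {0..1})" if "t \<in> {0..1}" for t
      proof -
        have "(?p has_derivative (\<lambda>s. s *\<^sub>R (y' - y))) (at t within {0..1})"
          by (auto intro!: derivative_eq_intros)
        from has_derivative_compose[OF this C1_on_has_derivative[OF G p[OF that]]]
        show ?thesis
          using G0[OF p[OF that], of "y' - y"] \<open>D *v y = D *v y'\<close>
          by (simp add: matrix_vector_mult_diff_distrib)
      qed
      from has_derivative_zero_unique[OF _ this, of 0 1] show ?thesis by simp
    qed
    define f where "f z = G (SOME y. y \<in> V \<and> D *v y = z)" for z
    have f: "f (D *v y) = G y" if "y \<in> V" for y
      unfolding f_def using someI[of "\<lambda>y'. y' \<in> V \<and> D *v y' = D *v y" y] that Geq by blast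
    have "C1_on ((*v) D ` V) f"
    proof (rule C1_on_local)
      fix z assume "z \<in> (*v) D ` V"
      then obtain y where y: "y \<in> V" "z = D *v y" by blast
      let ?s = "\<lambda>z'. y + B *v (z' - z)"
      let ?N = "?s -` V"
      have s: "(?s has_derivative (\<lambda>h. B *v h)) (at z')" for z'
        by (auto intro!: derivative_eq_intros bounded_linear.has_derivative[OF matrix_vector_mul_bounded_linear])
      have "open ?N"
        by (intro open_vimage continuous_intros bounded_linear.continuous_on[OF matrix_vector_mul_bounded_linear])
           (simp add: V_def)
      have C1s: "C1_on ?N (\<lambda>z'. ?s z' $ k)" for k
        by (rule C1_on_components[OF s]) (intro continuous_intros)
      have "C1_on ?N (\<lambda>z'. G (?s z'))"
        using C1_on_compose[where u = "\<lambda>k z'. ?s z' $ k", OF G C1s, unfolded tuple_components] by blast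
      moreover have "G (?s z') = f z'" if "z' \<in> ?N" for z'
      proof -
        have "D *v ?s z' = z'"
          by (simp add: matrix_vector_right_distrib matrix_vector_mult_diff_distrib DB y)
        then show ?thesis using f[of "?s z'"] that by auto
      qed
      ultimately have "C1_on ?N f" by (intro C1_on_cong[OF \<open>open ?N\<close>, of "\<lambda>z'. G (?s z')" f])
      then show "\<exists>T. open T \<and> z \<in> T \<and> C1_on T f"
        using \<open>open ?N\<close> y by (intro exI[of _ ?N] conjI) auto
    qed
    moreover have "g x = f (tuple \<phi> x)" if "x \<in> U" for x
      using that f defs(6) by (auto simp: U_def G_def)
    ultimately show "\<exists>f. C1_on (tuple \<phi> ` U) f \<and> (\<forall>x\<in>U. g x = f (tuple \<phi> x))"
      unfolding \<phi>U by blast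
  qed
qed

section \<open>Linear algebra of independent gradients\<close>

lemma jacobian_right_inverse:
  fixes \<phi> :: "'m::finite \<Rightarrow> real^'n::finite \<Rightarrow> real"
  assumes "functionally_independent_on E \<phi>" "x \<in> E"
  obtains B where "jacobian \<phi> x ** B = mat 1"
proof -
  let ?g = "\<lambda>i. gradient (\<phi> i) x"
  have inj: "inj ?g" and ind: "independent (range ?g)"
    using assms by (auto simp: functionally_independent_on_def)
  have "c i = 0" if "(\<Sum>i\<in>UNIV. c i *s row i (jacobian \<phi> x)) = 0" for c i
  proof -
    have row: "row i (jacobian \<phi> x) = ?g i" for i
      by (simp add: row_def jacobian_def)
    have "(\<Sum>v\<in>range ?g. c (inv ?g v) *\<^sub>R v) = (\<Sum>i\<in>UNIV. c i *\<^sub>R ?g i)"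
      by (simp add: sum.reindex[OF inj] inv_f_f[OF inj])
    also have "\<dots> = 0"
      using that by (simp add: row scalar_mult_eq_scaleR)
    finally have "c (inv ?g (?g i)) = 0"
      by (rule independentD[OF ind finite_imageI[OF finite] order_refl]) simp
    then show ?thesis by (simp add: inv_f_f[OF inj])
  qed
  then show thesis
    using that matrix_right_invertible_independent_rows[of "jacobian \<phi> x"] by blast
qed

text \<open>The kernel is the orthogonal complement of $n - 1$ independent gradients, hence a line.\<close>
lemma jacobian_kernel_spanned:
  fixes \<phi> :: "'m::finite \<Rightarrow> real^'n::finite \<Rightarrow> real"
  assumes "functionally_independent_on E \<phi>" "x \<in> E" and card: "CARD('n) = CARD('m) + 1"
    and "jacobian \<phi> x *v a = 0" "a \<noteq> 0" "jacobian \<phi> x *v v = 0"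
  obtains c where "v = c *\<^sub>R a"
proof -
  let ?g = "\<lambda>i. gradient (\<phi> i) x"
  let ?S = "span (range ?g)"
  let ?K = "{y \<in> UNIV. \<forall>x\<in>?S. orthogonal x y}"
  have inj: "inj ?g" and ind: "independent (range ?g)"
    using assms by (auto simp: functionally_independent_on_def)
  have "dim ?S = CARD('m)"
    using dim_eq_card_independent[OF ind] inj by (simp add: card_image)
  then have "dim ?K = 1"
    using dim_subspace_orthogonal_to_vectors[OF subspace_span subspace_UNIV subset_UNIV, of "range ?g"] card
    by simp
  moreover have ker: "y \<in> ?K" if "jacobian \<phi> x *v y = 0" for y
  proof -
    have "orthogonal y (?g i)" for i
      using arg_cong[OF that, of "\<lambda>v. v $ i"] by (simp add: jacobian_mult_nth orthogonal_def inner_commute)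
    then have "orthogonal y z" if "z \<in> ?S" for z
      using orthogonal_to_span[OF that, of y] by auto
    then show ?thesis by (simp add: orthogonal_commute)
  qed
  ultimately have "?K \<subseteq> span {a}"
    using assms by (intro card_ge_dim_independent) auto
  then have "v \<in> span {a}" using ker assms by blast
  then show thesis using that by (auto simp: span_singleton)
qed

section \<open>The algebra of solutions\<close>

lemma solutions_subset: "U \<subseteq> E \<Longrightarrow> solutions a q E \<subseteq> solutions a q U"
  unfolding solutions_def by (auto intro: C1_on_subset)

lemma solutions_cong:
  assumes "open U" "\<And>x. x \<in> U \<Longrightarrow> \<psi> x = \<psi>' x" "\<psi> \<in> solutions a q U"
  shows "\<psi>' \<in> solutions a q U"
proof -
  have \<psi>: "C1_on U \<psi>" using assms(3) by (simp add: solutions_def)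
  have "gradient \<psi>' x = gradient \<psi> x" if "x \<in> U" for x
    using \<psi> that by (intro gradient_cong[OF assms(1) that assms(2)]) (auto simp: C1_on_def)
  then show ?thesis
    using assms C1_on_cong[OF assms(1,2) \<psi>] by (simp add: solutions_def vf_apply_gradient)
qed

text \<open>By the Leibniz rule the zeroth-order coefficients add. Together with \<open>solutions_inverse\<close> this
  gives the correspondence $\psi = \eta g$ between solutions of $(L+q)\psi = 0$ and of $Lg = 0$.\<close>
lemma solutions_mult:
  assumes "f \<in> solutions a p U" "g \<in> solutions a q U"
  shows "(\<lambda>x. f x * g x) \<in> solutions a (\<lambda>x. p x + q x) U"
proof -
  have C1: "C1_on U f" "C1_on U g"
    and eq: "\<And>x. x \<in> U \<Longrightarrow> a x \<bullet> gradient f x = - p x * f x"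
      "\<And>x. x \<in> U \<Longrightarrow> a x \<bullet> gradient g x = - q x * g x"
    using assms by (auto simp: solutions_def vf_apply_gradient eq_neg_iff_add_eq_0)
  have "a x \<bullet> gradient (\<lambda>x. f x * g x) x + (p x + q x) * (f x * g x) = 0" if "x \<in> U" for x
    by (simp add: gradient_mult[OF C1 that] inner_add_right eq[OF that] algebra_simps)
  then show ?thesis
    using C1_on_mult[OF C1] by (simp add: solutions_def vf_apply_gradient)
qed

lemma solutions_inverse:
  assumes "f \<in> solutions a q U" and nz: "\<And>x. x \<in> U \<Longrightarrow> f x \<noteq> 0"
  shows "(\<lambda>x. inverse (f x)) \<in> solutions a (\<lambda>x. - q x) U"
proof -
  have C1: "C1_on U f"
    and eq: "\<And>x. x \<in> U \<Longrightarrow> a x \<bullet> gradient f x = - q x * f x"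
    using assms by (auto simp: solutions_def vf_apply_gradient eq_neg_iff_add_eq_0)
  have "a x \<bullet> gradient (\<lambda>x. inverse (f x)) x - q x * inverse (f x) = 0" if "x \<in> U" for x
    using nz[OF that] gradient_inverse[OF C1 nz that] eq[OF that] by (simp add: power2_eq_square)
  moreover have "C1_on U (\<lambda>x. inverse (f x))"
    by (rule C1_on_inverse[OF C1]) (rule nz)
  ultimately show ?thesis
    by (simp add: solutions_def vf_apply_gradient)
qed

lemma const_solution: "(\<lambda>x. c) \<in> solutions a (\<lambda>x. 0) U"
proof -
  have D: "((\<lambda>x. c) has_derivative (\<lambda>h. 0 \<bullet> h)) (at x)" for x :: "real^'n"
    by simp
  have "C1_on U (\<lambda>x. c)" by (rule C1_onI[OF D]) simp
  then show ?thesis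
    by (simp add: solutions_def vf_apply_gradient gradient_eqI[OF D])
qed

lemma jacobian_solutions_kernel:
  assumes "\<And>i. \<phi> i \<in> solutions a (\<lambda>x. 0) U" "x \<in> U"
  shows "jacobian \<phi> x *v a x = 0"
  using assms by (simp add: solutions_def vf_apply_gradient vec_eq_iff jacobian_mult_nth inner_commute)

lemma compose_solution:
  assumes \<phi>: "\<And>i. \<phi> i \<in> solutions a (\<lambda>x. 0) U" and f: "C1_on (tuple \<phi> ` U) f"
  shows "(\<lambda>x. f (tuple \<phi> x)) \<in> solutions a (\<lambda>x. 0) U"
proof -
  have C1: "\<And>i. C1_on U (\<phi> i)" using \<phi> by (simp add: solutions_def)
  have "gradient (\<lambda>x. f (tuple \<phi> x)) x \<bullet> a x = 0" if "x \<in> U" for x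
    using gradient_compose[OF f C1 order_refl that] jacobian_solutions_kernel[of \<phi>, OF \<phi> that] by simp
  then show ?thesis
    using C1_on_compose[OF f C1 order_refl] by (simp add: solutions_def vf_apply_gradient inner_commute)
qed

section \<open>First integrals as functions of independent first integrals\<close>

text \<open>Off the zeros of $a$, the kernel of $d\phi$ is the line spanned by $a$, so $Lg = 0$ says that
  $dg$ vanishes on it. The zeros of $a$ form the exceptional set of \<open>local_factorization\<close>.\<close>
lemma first_integral_local_factorization:
  fixes \<phi> :: "'m::finite \<Rightarrow> real^'n::finite \<Rightarrow> real"
  assumes "open E" "CARD('n) = CARD('m) + 1" "functionally_independent_on E \<phi>"
    and \<phi>: "\<And>i. \<phi> i \<in> solutions a (\<lambda>x. 0) E"
    and Z: "interior {x\<in>E. a x = 0} = {}"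
    and "x \<in> E" "open W" "x \<in> W"
  obtains U where "open U" "x \<in> U" "U \<subseteq> W \<inter> E" "open (tuple \<phi> ` U)"
    "\<And>g. g \<in> solutions a (\<lambda>x. 0) U \<Longrightarrow>
       \<exists>f. C1_on (tuple \<phi> ` U) f \<and> (\<forall>x\<in>U. g x = f (tuple \<phi> x))"
proof -
  obtain B where B: "jacobian \<phi> x ** B = mat 1"
    using jacobian_right_inverse assms by blast
  have \<phi>W: "C1_on (W \<inter> E) (\<phi> i)" for i
    using \<phi>[of i] by (auto simp: solutions_def intro: C1_on_subset)
  have WE: "open (W \<inter> E)" "x \<in> W \<inter> E" using assms by auto
  show thesis
  proof (rule local_factorization[OF WE \<phi>W B])
    fix U
    assume U: "open U" "x \<in> U" "U \<subseteq> W \<inter> E" "open (tuple \<phi> ` U)" and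
      fac: "\<And>g Z. C1_on U g \<Longrightarrow> interior Z = {} \<Longrightarrow>
         (\<And>x v. x \<in> U - Z \<Longrightarrow> jacobian \<phi> x *v v = 0 \<Longrightarrow> gradient g x \<bullet> v = 0) \<Longrightarrow>
         \<exists>f. C1_on (tuple \<phi> ` U) f \<and> (\<forall>x\<in>U. g x = f (tuple \<phi> x))"
    show thesis
    proof (rule that[OF U])
      fix g assume "g \<in> solutions a (\<lambda>x. 0) U"
      then have g: "C1_on U g" "\<And>x. x \<in> U \<Longrightarrow> a x \<bullet> gradient g x = 0"
        by (auto simp: solutions_def vf_apply_gradient)
      have "gradient g y \<bullet> v = 0" if y: "y \<in> U - {x\<in>E. a x = 0}" and v: "jacobian \<phi> y *v v = 0" for y v
      proof -
        have "y \<in> E" "a y \<noteq> 0" using y U(3) by auto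
        then obtain c where "v = c *\<^sub>R a y"
          using jacobian_kernel_spanned[OF assms(3) _ assms(2) jacobian_solutions_kernel[of \<phi>, OF \<phi>] _ v] by blast
        then show ?thesis using g(2) y by (simp add: inner_commute)
      qed
      then show "\<exists>f. C1_on (tuple \<phi> ` U) f \<and> (\<forall>x\<in>U. g x = f (tuple \<phi> x))"
        by (rule fac[OF g(1) Z])
    qed
  qed
qed

text \<open>The local factorizations make $g$ locally constant on each fibre of \<open>\<phi>\<close>. On connected fibres
  it is then constant, so that $f$ is determined on the whole image, where it agrees locally with
  the local $C^1$ factors.\<close>
lemma first_integral_global_factorization:
  fixes \<phi> :: "'m::finite \<Rightarrow> real^'n::finite \<Rightarrow> real"
  assumes "open E" "CARD('n) = CARD('m) + 1" "functionally_independent_on E \<phi>"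
    and "\<And>i. \<phi> i \<in> solutions a (\<lambda>x. 0) E"
    and "interior {x\<in>E. a x = 0} = {}"
    and conn: "\<And>y. connected {x\<in>E. tuple \<phi> x = y}"
    and g: "g \<in> solutions a (\<lambda>x. 0) E"
  obtains f where "C1_on (tuple \<phi> ` E) f" "\<And>x. x \<in> E \<Longrightarrow> g x = f (tuple \<phi> x)"
proof -
  have loc: "\<exists>U f. open U \<and> x \<in> U \<and> U \<subseteq> E \<and> open (tuple \<phi> ` U) \<and> C1_on (tuple \<phi> ` U) f \<and>
      (\<forall>x\<in>U. g x = f (tuple \<phi> x))" if xE: "x \<in> E" for x
  proof -
    obtain U where U: "open U" "x \<in> U" "U \<subseteq> UNIV \<inter> E" "open (tuple \<phi> ` U)"
      and fac: "\<And>g. g \<in> solutions a (\<lambda>x. 0) U \<Longrightarrow>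
        \<exists>f. C1_on (tuple \<phi> ` U) f \<and> (\<forall>x\<in>U. g x = f (tuple \<phi> x))"
      by (rule first_integral_local_factorization[OF assms(1-5) xE open_UNIV UNIV_I]) (rule that)
    have "g \<in> solutions a (\<lambda>x. 0) U" using g solutions_subset U(3) by blast
    from fac[OF this] U show ?thesis by auto
  qed
  have fibre: "g x = g x'" if "x \<in> E" "x' \<in> E" "tuple \<phi> x = tuple \<phi> x'" for x x'
  proof -
    let ?F = "{z\<in>E. tuple \<phi> z = tuple \<phi> x}"
    have "eventually (\<lambda>b. g z = g b) (at z within ?F)" if z: "z \<in> ?F" for z
    proof -
      from loc[of z] z obtain U f where U: "open U" "z \<in> U" "\<forall>x\<in>U. g x = f (tuple \<phi> x)"
        by auto
      then have "\<forall>b\<in>U. b \<in> ?F \<longrightarrow> g z = g b"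
        using z by simp
      with U(1,2) show ?thesis
        unfolding eventually_at_topological by blast
    qed
    then show ?thesis
      using connected_local_const[OF conn, of x "tuple \<phi> x" x' g] that by auto
  qed
  define f where "f y = g (SOME x. x \<in> E \<and> tuple \<phi> x = y)" for y
  have f: "f (tuple \<phi> x) = g x" if "x \<in> E" for x
    unfolding f_def using someI[of "\<lambda>x'. x' \<in> E \<and> tuple \<phi> x' = tuple \<phi> x" x] that fibre by blast
  have "C1_on (tuple \<phi> ` E) f"
  proof (rule C1_on_local)
    fix y assume "y \<in> tuple \<phi> ` E"
    then obtain x where x: "x \<in> E" "y = tuple \<phi> x" by blast
    from loc[OF x(1)] obtain U f' where U: "open (tuple \<phi> ` U)" "x \<in> U" "U \<subseteq> E" "C1_on (tuple \<phi> ` U) f'"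
      "\<forall>x\<in>U. g x = f' (tuple \<phi> x)"
      by auto
    have "C1_on (tuple \<phi> ` U) f"
      using U f by (intro C1_on_cong[OF U(1) _ U(4)]) auto
    then show "\<exists>T. open T \<and> y \<in> T \<and> C1_on T f"
      using U x by blast
  qed
  then show thesis using that f by metis
qed

text \<open>In dimension one $a$ spans the whole space wherever it does not vanish, so $Lg = 0$ forces
  $dg = 0$ there, and by continuity everywhere.\<close>
lemma first_integral_constant_dim1:
  fixes g :: "real^'n::finite \<Rightarrow> real"
  assumes card: "CARD('n) = 1" and "open U" "connected U" "U \<subseteq> E"
    and Z: "interior {x\<in>E. a x = 0} = {}"
    and "g \<in> solutions a (\<lambda>x. 0) U"
  obtains c where "\<And>x. x \<in> U \<Longrightarrow> g x = c"
proof -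
  have g: "C1_on U g" "\<And>x. x \<in> U \<Longrightarrow> a x \<bullet> gradient g x = 0"
    using assms by (auto simp: solutions_def vf_apply_gradient)
  have a0: "a x = 0" if "x \<in> U" "gradient g x \<noteq> 0" for x
  proof (rule ccontr)
    assume "a x \<noteq> 0"
    then have "UNIV \<subseteq> span {a x}"
      using card by (intro card_ge_dim_independent) auto
    then obtain c where "gradient g x = c *\<^sub>R a x" by (auto simp: span_singleton)
    then show False using g(2)[OF that(1)] that(2) \<open>a x \<noteq> 0\<close> by simp
  qed
  have "open (U \<inter> gradient g -` (- {0}))"
    by (intro continuous_open_preimage C1_on_continuous_gradient g assms) auto
  then have "U \<inter> gradient g -` (- {0}) \<subseteq> interior {x\<in>E. a x = 0}"
    using a0 \<open>U \<subseteq> E\<close> by (intro interior_maximal) auto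
  with Z have "gradient g x = 0" if "x \<in> U" for x using that by auto
  then have "(g has_derivative (\<lambda>h. 0)) (at x)" if "x \<in> U" for x
    using C1_on_has_derivative[OF g(1) that] that by simp
  then have "g x = g y" if "x \<in> U" "y \<in> U" for x y
    using has_derivative_zero_unique_connected[OF assms(2,3)] that by blast
  then show thesis using that by blast
qed

section \<open>The general solution\<close>

theorem mainTheorem10:
  fixes E :: "(real^'n::finite) set"
    and a :: "real^'n \<Rightarrow> real^'n"
    and q \<eta> :: "real^'n \<Rightarrow> real"
  assumes "open E"
    and "continuous_on E a"
    and "continuous_on E q"
    and "\<eta> \<in> solutions a q E"
    and "\<forall>x\<in>E. \<eta> x \<noteq> 0"
  shows "(\<forall>\<phi> :: 'm::finite \<Rightarrow> real^'n \<Rightarrow> real.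
            CARD('n) = CARD('m) + 1 \<and>
            (\<forall>i. \<phi> i \<in> solutions a (\<lambda>x. 0) E) \<and>
            functionally_independent_on E \<phi> \<longrightarrow>
              solution_forms \<eta> \<phi> E \<subseteq> solutions a q E \<and>
              (interior {x\<in>E. a x = 0} = {} \<longrightarrow>
                 local_general_solution a q E (solution_forms \<eta> \<phi>) \<and>
                 ((\<forall>y. connected {x\<in>E. tuple \<phi> x = y}) \<longrightarrow>
                    solutions a q E = solution_forms \<eta> \<phi> E)))
       \<and> (CARD('n) = 1 \<longrightarrow>
              solution_forms0 \<eta> E \<subseteq> solutions a q E \<and>
              (interior {x\<in>E. a x = 0} = {} \<longrightarrow>
                 local_general_solution a q E (solution_forms0 \<eta>) \<and>
                 (connected E \<longrightarrow> solutions a q E = solution_forms0 \<eta> E)))"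
proof -
  have \<eta>0: "\<And>x. x \<in> E \<Longrightarrow> \<eta> x \<noteq> 0" using assms by blast
  have \<eta>U: "\<eta> \<in> solutions a q U" if "U \<subseteq> E" for U
    using assms(4) solutions_subset[OF that] by blast
  have quot: "(\<lambda>x. \<psi> x * inverse (\<eta> x)) \<in> solutions a (\<lambda>x. 0) U"
    if "\<psi> \<in> solutions a q U" "U \<subseteq> E" for \<psi> U
    using solutions_mult[OF that(1) solutions_inverse[OF \<eta>U[OF that(2)]]] \<eta>0 that(2) by auto
  have prod: "\<psi> \<in> solutions a q U"
    if "open U" "U \<subseteq> E" "g \<in> solutions a (\<lambda>x. 0) U" "\<And>x. x \<in> U \<Longrightarrow> \<psi> x = \<eta> x * g x" for \<psi> g U
  proof -
    have "(\<lambda>x. \<eta> x * g x) \<in> solutions a q U"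
      using solutions_mult[OF \<eta>U[OF that(2)] that(3)] by simp
    then show ?thesis
      by (rule solutions_cong[OF that(1), rotated]) (simp add: that(4))
  qed
  \<comment> \<open>The value \<open>c\<close> stands for \<open>f (tuple \<phi> x)\<close>, or for a constant in dimension one.\<close>
  have times_back: "\<psi> x = \<eta> x * c" if "\<psi> x * inverse (\<eta> x) = c" "x \<in> E" for \<psi> x c
    using that \<eta>0 by (auto simp: field_simps)
  show ?thesis
  proof (intro conjI allI impI; (elim conjE)?)
    fix \<phi> :: "'m \<Rightarrow> real^'n \<Rightarrow> real"
    assume card: "CARD('n) = CARD('m) + 1"
      and \<phi>: "\<forall>i. \<phi> i \<in> solutions a (\<lambda>x. 0) E"
      and ind: "functionally_independent_on E \<phi>"
    have forms: "solution_forms \<eta> \<phi> U \<subseteq> solutions a q U" if "open U" "U \<subseteq> E" for U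
    proof -
      have "\<phi> i \<in> solutions a (\<lambda>x. 0) U" for i
        using \<phi> solutions_subset[OF that(2)] by blast
      then show ?thesis
        using prod[OF that compose_solution] unfolding solution_forms_def by blast
    qed
    show "solution_forms \<eta> \<phi> E \<subseteq> solutions a q E" by (intro forms assms(1) order_refl)
    assume Z: "interior {x\<in>E. a x = 0} = {}"
    note prems = assms(1) card ind \<phi>[rule_format] Z
    show "local_general_solution a q E (solution_forms \<eta> \<phi>)"
      unfolding local_general_solution_def
    proof (intro ballI allI impI; elim conjE)
      fix x W assume "x \<in> E" "open W" "x \<in> W"
      obtain U where U: "open U" "x \<in> U" "U \<subseteq> W \<inter> E"
        and fac: "\<And>g. g \<in> solutions a (\<lambda>x. 0) U \<Longrightarrow>
          \<exists>f. C1_on (tuple \<phi> ` U) f \<and> (\<forall>x\<in>U. g x = f (tuple \<phi> x))"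
        by (rule first_integral_local_factorization[OF prems \<open>x \<in> E\<close> \<open>open W\<close> \<open>x \<in> W\<close>]) (rule that)
      have "\<psi> \<in> solution_forms \<eta> \<phi> U" if "\<psi> \<in> solutions a q U" for \<psi>
        using fac[OF quot[OF that]] U times_back unfolding solution_forms_def by blast
      then have "solutions a q U = solution_forms \<eta> \<phi> U"
        using forms[OF U(1)] U(3) by blast
      then show "\<exists>U. open U \<and> x \<in> U \<and> U \<subseteq> W \<inter> E \<and> solutions a q U = solution_forms \<eta> \<phi> U"
        using U by blast
    qed
    assume conn: "\<forall>y. connected {x\<in>E. tuple \<phi> x = y}"
    have "\<psi> \<in> solution_forms \<eta> \<phi> E" if \<psi>: "\<psi> \<in> solutions a q E" for \<psi>
    proof -
      obtain f where "C1_on (tuple \<phi> ` E) f" "\<And>x. x \<in> E \<Longrightarrow> \<psi> x * inverse (\<eta> x) = f (tuple \<phi> x)"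
        by (rule first_integral_global_factorization[OF prems conn[rule_format] quot[OF \<psi> order_refl]])
          (rule that)
      then show ?thesis using times_back unfolding solution_forms_def by blast
    qed
    then show "solutions a q E = solution_forms \<eta> \<phi> E"
      using forms[OF assms(1) order_refl] by blast
  next
    assume card: "CARD('n) = 1"
    have forms: "solution_forms0 \<eta> U \<subseteq> solutions a q U" if "open U" "U \<subseteq> E" for U
      using prod[OF that const_solution] unfolding solution_forms0_def by blast
    show "solution_forms0 \<eta> E \<subseteq> solutions a q E" by (intro forms assms(1) order_refl)
    assume Z: "interior {x\<in>E. a x = 0} = {}"
    have eq: "solutions a q U = solution_forms0 \<eta> U" if U: "open U" "U \<subseteq> E" "connected U" for U
    proof -
      have "\<psi> \<in> solution_forms0 \<eta> U" if \<psi>: "\<psi> \<in> solutions a q U" for \<psi>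
      proof -
        obtain c where "\<And>x. x \<in> U \<Longrightarrow> \<psi> x * inverse (\<eta> x) = c"
          by (rule first_integral_constant_dim1[OF card U(1,3,2) Z quot[OF \<psi> U(2)]]) (rule that)
        then show ?thesis using times_back U(2) unfolding solution_forms0_def by blast
      qed
      then show ?thesis using forms[OF U(1,2)] by blast
    qed
    then show "connected E \<Longrightarrow> solutions a q E = solution_forms0 \<eta> E" using assms(1) by blast
    show "local_general_solution a q E (solution_forms0 \<eta>)"
      unfolding local_general_solution_def
    proof (intro ballI allI impI; elim conjE)
      fix x W assume "x \<in> E" "open W" "x \<in> W"
      then obtain r where "r > 0" "ball x r \<subseteq> W \<inter> E"
        using assms(1) openE[of "W \<inter> E" x] by blast
      then show "\<exists>U. open U \<and> x \<in> U \<and> U \<subseteq> W \<inter> E \<and> solutions a q U = solution_forms0 \<eta> U"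
        using eq by (intro exI[of _ "ball x r"]) auto
    qed
  qed
qed

end
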